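(* Let $G$ be an abelian topological group. The operations of multiplication $(T,S)\mapsto TS$ and inversion $T\mapsto T^{-1}$ are continuous in $\mathsf{Hom}_{\mathsf{c}}(G)$ with respect to the topology of $\mathsf{c}$-convergence, i.e. $\mathsf{Hom}_{\mathsf{c}}(G)$ is a topological group.
   Context: $e_G$ denotes the identity element of $G$. $\mathsf{Hom}_{\mathsf{c}}(G)$ is the class of all continuous group homomorphisms $G\to G$. For homomorphisms $T,S$ on $G$, the operations are pointwise: $(TS)(x):=T(x)S(x)$ and $T^{-1}(x):=(T(x))^{-1}$ for $x\in G$. $\mathsf{Hom}_{\mathsf{c}}(G)$ is equipped with the topology of $\mathsf{c}$-convergence: a net $(S_\alpha)$ of continuous homomorphisms $\mathsf{c}$-converges to a homomorphism $S$ if for each neighborhood $W$ of $e_G$ there is a neighborhood $U$ of $e_G$ such that for every neighborhood $V$ of $e_G$ there exists an $\alpha_0$ with $(S_\alpha S^{-1})(U)\subset VW$ for each $\alpha\ge\alpha_0$. Here $VW=\{vw:v\in V,\ w\in W\}$. Continuity of the operations is understood with respect to this convergence of nets. *)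

theory Defs
  imports "HOL-Algebra.Coset" "HOL-Analysis.Product_Topology"
begin

text \<open>No separation axiom is assumed.\<close>

locale topological_group = group G for G (structure) +
  fixes X :: "'a topology"
  assumes topspace_eq: "topspace X = carrier G"
    and continuous_mult: "continuous_map (prod_topology X X) X (\<lambda>(x, y). x \<otimes> y)"
    and continuous_inv: "continuous_map X X (\<lambda>x. inv x)"

text \<open>Neighbourhoods need not be open.\<close>

definition nhd_one :: "('a, 'b) monoid_scheme \<Rightarrow> 'a topology \<Rightarrow> 'a set \<Rightarrow> bool" where
  "nhd_one G X W \<longleftrightarrow> W \<subseteq> topspace X \<and> \<one>\<^bsub>G\<^esub> \<in> X interior_of W"

definition hom_mult :: "('a, 'b) monoid_scheme \<Rightarrow> ('a \<Rightarrow> 'a) \<Rightarrow> ('a \<Rightarrow> 'a) \<Rightarrow> 'a \<Rightarrow> 'a" where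
  "hom_mult G T S = (\<lambda>x\<in>carrier G. T x \<otimes>\<^bsub>G\<^esub> S x)"

definition hom_inv :: "('a, 'b) monoid_scheme \<Rightarrow> ('a \<Rightarrow> 'a) \<Rightarrow> 'a \<Rightarrow> 'a" where
  "hom_inv G T = (\<lambda>x\<in>carrier G. inv\<^bsub>G\<^esub> (T x))"

text \<open>
  The multiplication is pointwise, not composition. Since only the values on the carrier
  of \<open>G\<close> matter, homomorphisms are represented by extensional functions, so that HOL
  equality is equality of maps on the carrier.
\<close>

definition Hom_c :: "('a, 'b) monoid_scheme \<Rightarrow> 'a topology \<Rightarrow> ('a \<Rightarrow> 'a) monoid" where
  "Hom_c G X =
    \<lparr>carrier = {T \<in> extensional (carrier G). T \<in> hom G G \<and> continuous_map X X T},
     mult = hom_mult G,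
     one = (\<lambda>x\<in>carrier G. \<one>\<^bsub>G\<^esub>)\<rparr>"

definition directed_set :: "'i set \<Rightarrow> ('i \<Rightarrow> 'i \<Rightarrow> bool) \<Rightarrow> bool" where
  "directed_set I prec \<longleftrightarrow> I \<noteq> {} \<and> reflp_on I prec \<and> transp_on I prec \<and>
     (\<forall>a\<in>I. \<forall>b\<in>I. \<exists>c\<in>I. prec a c \<and> prec b c)"

text \<open>
  The net \<open>Sn\<close> is indexed by the set \<open>I\<close>, directed by the preorder \<open>prec\<close>.
  Note the order of the quantifiers: \<open>U\<close> depends on \<open>W\<close> but not on \<open>V\<close>.
\<close>

definition c_converges ::
  "('a, 'b) monoid_scheme \<Rightarrow> 'a topology \<Rightarrow> 'i set \<Rightarrow> ('i \<Rightarrow> 'i \<Rightarrow> bool) \<Rightarrow>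
    ('i \<Rightarrow> 'a \<Rightarrow> 'a) \<Rightarrow> ('a \<Rightarrow> 'a) \<Rightarrow> bool" where
  "c_converges G X I prec Sn S \<longleftrightarrow>
     directed_set I prec \<and> (\<forall>\<alpha>\<in>I. Sn \<alpha> \<in> carrier (Hom_c G X)) \<and> S \<in> hom G G \<and>
     (\<forall>W. nhd_one G X W \<longrightarrow>
       (\<exists>U. nhd_one G X U \<and>
         (\<forall>V. nhd_one G X V \<longrightarrow>
           (\<exists>\<alpha>\<^sub>0\<in>I. \<forall>\<alpha>\<in>I. prec \<alpha>\<^sub>0 \<alpha> \<longrightarrow>
             hom_mult G (Sn \<alpha>) (hom_inv G S) ` U \<subseteq> V <#>\<^bsub>G\<^esub> W))))"

end

theory Submission
  imports Defs
begin

text \<open>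
  Write \<open>D\<^sub>\<alpha> = T\<^sub>\<alpha> T\<inverse>\<close> and \<open>E\<^sub>\<alpha> = S\<^sub>\<alpha> S\<inverse>\<close>. Since \<open>G\<close> is abelian, the error of the
  product net is the product of the errors, \<open>(T\<^sub>\<alpha> S\<^sub>\<alpha>) (T S)\<inverse> = D\<^sub>\<alpha> E\<^sub>\<alpha>\<close>, and the error of
  the net of inverses is \<open>D\<^sub>\<alpha>\<inverse>\<close>. So \<open>D\<^sub>\<alpha>(x) \<in> V' W'\<close> and \<open>E\<^sub>\<alpha>(x) \<in> V' W'\<close> give
  \<open>D\<^sub>\<alpha>(x) E\<^sub>\<alpha>(x) \<in> (V' V') (W' W') \<subseteq> V W\<close> as soon as \<open>V' V' \<subseteq> V\<close> and \<open>W' W' \<subseteq> W\<close>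
  (\<open>nhd_one_square\<close>), and \<open>D\<^sub>\<alpha>(x) \<in> V\<inverse> W\<inverse>\<close> gives \<open>D\<^sub>\<alpha>(x)\<inverse> \<in> V W\<close> (\<open>nhd_one_inv\<close>).

  The order of the quantifiers is respected because \<open>W'\<close> is obtained from \<open>W\<close> alone and \<open>V'\<close>
  from \<open>V\<close> alone: the neighbourhood \<open>U\<close>, which is the intersection of those supplied for \<open>W'\<close>
  by the two nets, is fixed before \<open>V\<close> is given.

  Commutativity is also what makes pointwise products and inverses of homomorphisms
  homomorphisms again.
\<close>

section \<open>Neighbourhoods of the identity\<close>

lemma nhd_one_iff:
  "nhd_one G X W \<longleftrightarrow> W \<subseteq> topspace X \<and> (\<exists>Q. openin X Q \<and> \<one>\<^bsub>G\<^esub> \<in> Q \<and> Q \<subseteq> W)"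
  by (auto simp: nhd_one_def interior_of_def)

lemma nhd_one_Int: "nhd_one G X V \<Longrightarrow> nhd_one G X W \<Longrightarrow> nhd_one G X (V \<inter> W)"
  by (auto simp: nhd_one_def interior_of_Int)

context topological_group
begin

lemma nhd_one_subset: "nhd_one G X W \<Longrightarrow> W \<subseteq> carrier G"
  by (simp add: nhd_one_def topspace_eq)

text \<open>
  By continuity of the multiplication at \<open>(\<one>, \<one>)\<close>, some box \<open>A \<times> B\<close> of open sets is mapped
  into \<open>W\<close>; the intersection of its sides is the required \<open>V\<close>.
\<close>

lemma nhd_one_square:
  assumes "nhd_one G X W"
  obtains V where "nhd_one G X V" "V <#> V \<subseteq> W"
proof -
  obtain Q where Q: "openin X Q" "\<one> \<in> Q" "Q \<subseteq> W"
    using assms by (auto simp: nhd_one_iff)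
  define P where "P = {p \<in> topspace (prod_topology X X). (case p of (x, y) \<Rightarrow> x \<otimes> y) \<in> Q}"
  have "openin (prod_topology X X) P"
    unfolding P_def by (rule openin_continuous_map_preimage [OF continuous_mult Q(1)])
  moreover have "(\<one>, \<one>) \<in> P"
    using Q by (simp add: P_def topspace_eq)
  ultimately obtain A B where AB: "openin X A" "openin X B" "\<one> \<in> A" "\<one> \<in> B" "A \<times> B \<subseteq> P"
    unfolding openin_prod_topology_alt by meson
  have "nhd_one G X (A \<inter> B)"
    using AB openin_Int [OF AB(1,2)] openin_subset [OF AB(1)] by (auto simp: nhd_one_iff)
  moreover have "A \<inter> B <#> A \<inter> B \<subseteq> W"
    using AB(5) Q(3) by (auto simp: P_def set_mult_def)
  ultimately show ?thesis
    using that by blast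
qed

lemma nhd_one_inv:
  assumes "nhd_one G X W"
  shows "nhd_one G X {x \<in> carrier G. inv x \<in> W}"
proof -
  obtain Q where Q: "openin X Q" "\<one> \<in> Q" "Q \<subseteq> W"
    using assms by (auto simp: nhd_one_iff)
  have "openin X {x \<in> topspace X. inv x \<in> Q}"
    by (rule openin_continuous_map_preimage [OF continuous_inv Q(1)])
  with Q show ?thesis
    unfolding nhd_one_iff topspace_eq by (intro conjI exI [of _ "{x \<in> carrier G. inv x \<in> Q}"]) auto
qed

end

section \<open>The group of continuous endomorphisms\<close>

lemma mem_Hom_c:
  "T \<in> carrier (Hom_c G X) \<longleftrightarrow>
     T \<in> extensional (carrier G) \<and> T \<in> hom G G \<and> continuous_map X X T"
  by (simp add: Hom_c_def)

lemma mult_Hom_c: "T \<otimes>\<^bsub>Hom_c G X\<^esub> S = hom_mult G T S"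
  by (simp add: Hom_c_def)

locale topological_comm_group = topological_group + comm_group G
begin

lemma hom_mult_hom: "T \<in> hom G G \<Longrightarrow> S \<in> hom G G \<Longrightarrow> hom_mult G T S \<in> hom G G"
  by (auto simp: hom_def Pi_iff hom_mult_def m_ac)

lemma hom_inv_hom: "T \<in> hom G G \<Longrightarrow> hom_inv G T \<in> hom G G"
  by (auto simp: hom_def Pi_iff hom_inv_def inv_mult)

lemma hom_mult_closed:
  assumes "T \<in> carrier (Hom_c G X)" "S \<in> carrier (Hom_c G X)"
  shows "hom_mult G T S \<in> carrier (Hom_c G X)"
proof -
  have "continuous_map X (prod_topology X X) (\<lambda>x. (T x, S x))"
    using assms by (auto simp: mem_Hom_c intro: continuous_map_pairedI)
  from continuous_map_compose [OF this continuous_mult]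
  have "continuous_map X X (hom_mult G T S)"
    by (rule continuous_map_eq) (simp add: hom_mult_def topspace_eq)
  with assms show ?thesis
    by (auto simp: mem_Hom_c hom_mult_hom) (simp add: hom_mult_def)
qed

lemma hom_inv_closed:
  assumes "T \<in> carrier (Hom_c G X)"
  shows "hom_inv G T \<in> carrier (Hom_c G X)"
proof -
  have "continuous_map X X T"
    using assms by (simp add: mem_Hom_c)
  from continuous_map_compose [OF this continuous_inv]
  have "continuous_map X X (hom_inv G T)"
    by (rule continuous_map_eq) (simp add: hom_inv_def topspace_eq)
  with assms show ?thesis
    by (auto simp: mem_Hom_c hom_inv_hom) (simp add: hom_inv_def)
qed

lemma hom_inv_left:
  assumes "T \<in> carrier (Hom_c G X)"
  shows "hom_inv G T \<otimes>\<^bsub>Hom_c G X\<^esub> T = \<one>\<^bsub>Hom_c G X\<^esub>"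
  using assms
  by (auto simp: Hom_c_def hom_mult_def hom_inv_def hom_def Pi_iff intro!: restrict_ext)

lemma group_Hom_c: "group (Hom_c G X)"
proof (rule groupI)
  fix T S assume "T \<in> carrier (Hom_c G X)" "S \<in> carrier (Hom_c G X)"
  then show "T \<otimes>\<^bsub>Hom_c G X\<^esub> S \<in> carrier (Hom_c G X)"
    by (simp add: mult_Hom_c hom_mult_closed)
next
  show "\<one>\<^bsub>Hom_c G X\<^esub> \<in> carrier (Hom_c G X)"
    by (auto simp: Hom_c_def hom_def topspace_eq
        intro: continuous_map_eq [OF continuous_map_const [THEN iffD2]])
next
  fix R S T
  assume "R \<in> carrier (Hom_c G X)" "S \<in> carrier (Hom_c G X)" "T \<in> carrier (Hom_c G X)"
  then show "R \<otimes>\<^bsub>Hom_c G X\<^esub> S \<otimes>\<^bsub>Hom_c G X\<^esub> T =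
      R \<otimes>\<^bsub>Hom_c G X\<^esub> (S \<otimes>\<^bsub>Hom_c G X\<^esub> T)"
    by (auto simp: Hom_c_def hom_mult_def hom_def Pi_iff m_assoc intro!: restrict_ext)
next
  fix T assume T: "T \<in> carrier (Hom_c G X)"
  then have "T \<in> extensional (carrier G)" "T \<in> carrier G \<rightarrow> carrier G"
    by (auto simp: mem_Hom_c hom_def)
  then show "\<one>\<^bsub>Hom_c G X\<^esub> \<otimes>\<^bsub>Hom_c G X\<^esub> T = T"
    by (auto simp: Hom_c_def hom_mult_def extensional_def Pi_iff fun_eq_iff)
  show "\<exists>S\<in>carrier (Hom_c G X). S \<otimes>\<^bsub>Hom_c G X\<^esub> T = \<one>\<^bsub>Hom_c G X\<^esub>"
    using T hom_inv_closed hom_inv_left by blast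
qed

lemma inv_Hom_c:
  "T \<in> carrier (Hom_c G X) \<Longrightarrow> inv\<^bsub>Hom_c G X\<^esub> T = hom_inv G T"
  by (intro group.inv_equality [OF group_Hom_c] hom_inv_left hom_inv_closed)

section \<open>Continuity of the operations\<close>

lemma c_convergesE:
  assumes "c_converges G X I prec Sn S" "nhd_one G X W"
  obtains U where "nhd_one G X U"
    "\<forall>V. nhd_one G X V \<longrightarrow>
      (\<exists>\<alpha>\<^sub>0\<in>I. \<forall>\<alpha>\<in>I. prec \<alpha>\<^sub>0 \<alpha> \<longrightarrow>
        hom_mult G (Sn \<alpha>) (hom_inv G S) ` U \<subseteq> V <#> W)"
proof -
  have "\<exists>U. nhd_one G X U \<and> (\<forall>V. nhd_one G X V \<longrightarrow>
      (\<exists>\<alpha>\<^sub>0\<in>I. \<forall>\<alpha>\<in>I. prec \<alpha>\<^sub>0 \<alpha> \<longrightarrow>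
        hom_mult G (Sn \<alpha>) (hom_inv G S) ` U \<subseteq> V <#> W))"
    using assms by (simp add: c_converges_def)
  then show ?thesis
    by (elim exE conjE) (rule that)
qed

lemma error_hom_mult:
  assumes "T \<in> hom G G" "S \<in> hom G G" "T' \<in> hom G G" "S' \<in> hom G G" "x \<in> carrier G"
  shows "hom_mult G (hom_mult G T' S') (hom_inv G (hom_mult G T S)) x =
    hom_mult G T' (hom_inv G T) x \<otimes> hom_mult G S' (hom_inv G S) x"
  using assms by (simp add: hom_mult_def hom_inv_def hom_in_carrier inv_mult m_ac)

lemma error_hom_inv:
  assumes "T \<in> hom G G" "T' \<in> hom G G" "x \<in> carrier G"
  shows "hom_mult G (hom_inv G T') (hom_inv G (hom_inv G T)) x =
    inv (hom_mult G T' (hom_inv G T) x)"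
  using assms by (simp add: hom_mult_def hom_inv_def hom_in_carrier inv_mult)

text \<open>
  Commutativity sorts the factors so that the two from \<open>A\<close> stand together, as do the two from
  \<open>B\<close>. With \<open>A = V'\<close> and \<open>B = W'\<close> this is what allows \<open>V'\<close> and \<open>W'\<close> to be chosen
  independently of each other.
\<close>

lemma set_mult_interchange:
  assumes "A \<subseteq> carrier G" "B \<subseteq> carrier G" "a \<in> A <#> B" "b \<in> A <#> B"
  shows "a \<otimes> b \<in> (A <#> A) <#> (B <#> B)"
proof -
  obtain v w where vw: "v \<in> A" "w \<in> B" "a = v \<otimes> w"
    using assms(3) by (auto simp: set_mult_def)
  obtain v' w' where vw': "v' \<in> A" "w' \<in> B" "b = v' \<otimes> w'"
    using assms(4) by (auto simp: set_mult_def)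
  have "v \<in> carrier G" "v' \<in> carrier G" "w \<in> carrier G" "w' \<in> carrier G"
    using vw vw' assms(1,2) by auto
  then have "a \<otimes> b = (v \<otimes> v') \<otimes> (w \<otimes> w')"
    by (simp add: vw vw' m_ac)
  then show ?thesis
    using vw vw' by (auto simp: set_mult_def)
qed

lemma c_converges_hom_mult:
  assumes T: "c_converges G X I prec Tn T" and S: "c_converges G X I prec Sn S"
  shows "c_converges G X I prec (\<lambda>\<alpha>. hom_mult G (Tn \<alpha>) (Sn \<alpha>)) (hom_mult G T S)"
  unfolding c_converges_def
proof (intro conjI allI impI ballI)
  show dir: "directed_set I prec"
    using T by (simp add: c_converges_def)
  have Tn: "Tn \<alpha> \<in> carrier (Hom_c G X)" and Sn: "Sn \<alpha> \<in> carrier (Hom_c G X)"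
    if "\<alpha> \<in> I" for \<alpha>
    using T S that by (auto simp: c_converges_def)
  then show "hom_mult G (Tn \<alpha>) (Sn \<alpha>) \<in> carrier (Hom_c G X)" if "\<alpha> \<in> I" for \<alpha>
    using that by (simp add: hom_mult_closed)
  have homs: "T \<in> hom G G" "S \<in> hom G G"
    using T S by (auto simp: c_converges_def)
  then show "hom_mult G T S \<in> hom G G"
    by (rule hom_mult_hom)
  fix W assume "nhd_one G X W"
  then obtain W' where W': "nhd_one G X W'" "W' <#> W' \<subseteq> W"
    by (rule nhd_one_square)
  obtain U1 where U1: "nhd_one G X U1" and T_conv: "\<forall>V. nhd_one G X V \<longrightarrow>
      (\<exists>\<alpha>\<^sub>0\<in>I. \<forall>\<alpha>\<in>I. prec \<alpha>\<^sub>0 \<alpha> \<longrightarrow> hom_mult G (Tn \<alpha>) (hom_inv G T) ` U1 \<subseteq> V <#> W')"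
    by (rule c_convergesE [OF T W'(1)])
  obtain U2 where U2: "nhd_one G X U2" and S_conv: "\<forall>V. nhd_one G X V \<longrightarrow>
      (\<exists>\<alpha>\<^sub>0\<in>I. \<forall>\<alpha>\<in>I. prec \<alpha>\<^sub>0 \<alpha> \<longrightarrow> hom_mult G (Sn \<alpha>) (hom_inv G S) ` U2 \<subseteq> V <#> W')"
    by (rule c_convergesE [OF S W'(1)])
  show "\<exists>U. nhd_one G X U \<and> (\<forall>V. nhd_one G X V \<longrightarrow>
      (\<exists>\<alpha>\<^sub>0\<in>I. \<forall>\<alpha>\<in>I. prec \<alpha>\<^sub>0 \<alpha> \<longrightarrow>
        hom_mult G (hom_mult G (Tn \<alpha>) (Sn \<alpha>)) (hom_inv G (hom_mult G T S)) ` U \<subseteq> V <#> W))"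
  proof (intro exI [of _ "U1 \<inter> U2"] conjI allI impI)
    show "nhd_one G X (U1 \<inter> U2)"
      using U1 U2 by (rule nhd_one_Int)
    fix V assume "nhd_one G X V"
    then obtain V' where V': "nhd_one G X V'" "V' <#> V' \<subseteq> V"
      by (rule nhd_one_square)
    obtain a where a: "a \<in> I"
      "\<And>\<alpha>. \<alpha> \<in> I \<Longrightarrow> prec a \<alpha> \<Longrightarrow> hom_mult G (Tn \<alpha>) (hom_inv G T) ` U1 \<subseteq> V' <#> W'"
      using T_conv [THEN spec, THEN mp, OF V'(1)] by blast
    obtain b where b: "b \<in> I"
      "\<And>\<alpha>. \<alpha> \<in> I \<Longrightarrow> prec b \<alpha> \<Longrightarrow> hom_mult G (Sn \<alpha>) (hom_inv G S) ` U2 \<subseteq> V' <#> W'"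
      using S_conv [THEN spec, THEN mp, OF V'(1)] by blast
    \<comment> \<open>Directedness gives an index beyond which both errors are controlled.\<close>
    obtain c where c: "c \<in> I" "prec a c" "prec b c"
      using dir a(1) b(1) by (auto simp: directed_set_def)
    show "\<exists>\<alpha>\<^sub>0\<in>I. \<forall>\<alpha>\<in>I. prec \<alpha>\<^sub>0 \<alpha> \<longrightarrow>
      hom_mult G (hom_mult G (Tn \<alpha>) (Sn \<alpha>)) (hom_inv G (hom_mult G T S)) ` (U1 \<inter> U2)
        \<subseteq> V <#> W"
    proof (intro bexI [OF _ c(1)] ballI impI image_subsetI)
      fix \<alpha> x assume \<alpha>: "\<alpha> \<in> I" "prec c \<alpha>" and x: "x \<in> U1 \<inter> U2"
      have "transp_on I prec"
        using dir by (simp add: directed_set_def)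
      then have "prec a \<alpha>" "prec b \<alpha>"
        using a(1) b(1) c \<alpha> by (meson transp_onD)+
      then have "hom_mult G (Tn \<alpha>) (hom_inv G T) x \<otimes> hom_mult G (Sn \<alpha>) (hom_inv G S) x
          \<in> (V' <#> V') <#> (W' <#> W')"
        using a(2) [OF \<alpha>(1)] b(2) [OF \<alpha>(1)] x
        by (intro set_mult_interchange nhd_one_subset [OF V'(1)] nhd_one_subset [OF W'(1)]) auto
      also have "\<dots> \<subseteq> V <#> W"
        using V'(2) W'(2) by (rule mono_set_mult)
      finally show "hom_mult G (hom_mult G (Tn \<alpha>) (Sn \<alpha>)) (hom_inv G (hom_mult G T S)) x
          \<in> V <#> W"
        using homs Tn Sn \<alpha>(1) x nhd_one_subset [OF U1]
        by (subst error_hom_mult) (auto simp: mem_Hom_c)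
    qed
  qed
qed

lemma c_converges_hom_inv:
  assumes T: "c_converges G X I prec Tn T"
  shows "c_converges G X I prec (\<lambda>\<alpha>. hom_inv G (Tn \<alpha>)) (hom_inv G T)"
  unfolding c_converges_def
proof (intro conjI allI impI ballI)
  show "directed_set I prec"
    using T by (simp add: c_converges_def)
  have Tn: "Tn \<alpha> \<in> carrier (Hom_c G X)" if "\<alpha> \<in> I" for \<alpha>
    using T that by (auto simp: c_converges_def)
  then show "hom_inv G (Tn \<alpha>) \<in> carrier (Hom_c G X)" if "\<alpha> \<in> I" for \<alpha>
    using that by (simp add: hom_inv_closed)
  have hom: "T \<in> hom G G"
    using T by (auto simp: c_converges_def)
  then show "hom_inv G T \<in> hom G G"
    by (rule hom_inv_hom)
  fix W assume "nhd_one G X W"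
  then have W': "nhd_one G X {x \<in> carrier G. inv x \<in> W}" (is "nhd_one G X ?W'")
    by (rule nhd_one_inv)
  obtain U where U: "nhd_one G X U" and T_conv: "\<forall>V. nhd_one G X V \<longrightarrow>
      (\<exists>\<alpha>\<^sub>0\<in>I. \<forall>\<alpha>\<in>I. prec \<alpha>\<^sub>0 \<alpha> \<longrightarrow> hom_mult G (Tn \<alpha>) (hom_inv G T) ` U \<subseteq> V <#> ?W')"
    by (rule c_convergesE [OF T W'])
  show "\<exists>U. nhd_one G X U \<and> (\<forall>V. nhd_one G X V \<longrightarrow>
      (\<exists>\<alpha>\<^sub>0\<in>I. \<forall>\<alpha>\<in>I. prec \<alpha>\<^sub>0 \<alpha> \<longrightarrow>
        hom_mult G (hom_inv G (Tn \<alpha>)) (hom_inv G (hom_inv G T)) ` U \<subseteq> V <#> W))"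
  proof (intro exI [of _ U] conjI allI impI)
    fix V assume "nhd_one G X V"
    then have V': "nhd_one G X {x \<in> carrier G. inv x \<in> V}" (is "nhd_one G X ?V'")
      by (rule nhd_one_inv)
    obtain a where a: "a \<in> I"
      "\<And>\<alpha>. \<alpha> \<in> I \<Longrightarrow> prec a \<alpha> \<Longrightarrow> hom_mult G (Tn \<alpha>) (hom_inv G T) ` U \<subseteq> ?V' <#> ?W'"
      using T_conv [THEN spec, THEN mp, OF V'] by blast
    have inv_mem: "inv z \<in> V <#> W" if z: "z \<in> ?V' <#> ?W'" for z
    proof -
      obtain v w where "v \<in> ?V'" "w \<in> ?W'" "z = v \<otimes> w"
        using z by (auto simp: set_mult_def)
      then have "inv v \<in> V" "inv w \<in> W" "inv z = inv v \<otimes> inv w"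
        by (auto simp: inv_mult)
      then show ?thesis
        unfolding set_mult_def by blast
    qed
    show "\<exists>\<alpha>\<^sub>0\<in>I. \<forall>\<alpha>\<in>I. prec \<alpha>\<^sub>0 \<alpha> \<longrightarrow>
      hom_mult G (hom_inv G (Tn \<alpha>)) (hom_inv G (hom_inv G T)) ` U \<subseteq> V <#> W"
    proof (intro bexI [OF _ a(1)] ballI impI image_subsetI)
      fix \<alpha> x assume \<alpha>: "\<alpha> \<in> I" "prec a \<alpha>" and x: "x \<in> U"
      then have "inv (hom_mult G (Tn \<alpha>) (hom_inv G T) x) \<in> V <#> W"
        using a(2) by (intro inv_mem) blast
      then show "hom_mult G (hom_inv G (Tn \<alpha>)) (hom_inv G (hom_inv G T)) x \<in> V <#> W"
        using hom Tn \<alpha>(1) x nhd_one_subset [OF U]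
        by (subst error_hom_inv) (auto simp: mem_Hom_c)
    qed
  qed (rule U)
qed

end

theorem theorem2p9:
  fixes G :: "('a, 'b) monoid_scheme" and X :: "'a topology"
  assumes "topological_group G X" and "comm_group G"
  shows
    "group (Hom_c G X) \<and>
     (\<forall>T\<in>carrier (Hom_c G X). inv\<^bsub>Hom_c G X\<^esub> T = hom_inv G T) \<and>
     (\<forall>(I :: 'i set) prec Tn Sn. \<forall>T\<in>carrier (Hom_c G X). \<forall>S\<in>carrier (Hom_c G X).
        c_converges G X I prec Tn T \<and> c_converges G X I prec Sn S \<longrightarrow>
        c_converges G X I prec (\<lambda>\<alpha>. Tn \<alpha> \<otimes>\<^bsub>Hom_c G X\<^esub> Sn \<alpha>) (T \<otimes>\<^bsub>Hom_c G X\<^esub> S)) \<and>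
     (\<forall>(I :: 'i set) prec Tn. \<forall>T\<in>carrier (Hom_c G X).
        c_converges G X I prec Tn T \<longrightarrow>
        c_converges G X I prec (\<lambda>\<alpha>. hom_inv G (Tn \<alpha>)) (hom_inv G T))"
proof -
  interpret topological_comm_group G X
    using assms by (simp add: topological_comm_group_def)
  show ?thesis
    by (simp add: group_Hom_c inv_Hom_c mult_Hom_c c_converges_hom_mult c_converges_hom_inv)
qed

end
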